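(* Let $F \subseteq \{\land,\lor,\to,\neg\}$ be a fragment of intuitionistic propositional logic with $\{\lor,\neg\} \subseteq F$. Then $F$ does not have a finite semantics; that is, there do not exist an algebra $\mathfrak{A}_F$ with finite universe $V$ and a subset $D \subseteq V$ such that for every $\Gamma \cup \{\varphi\} \subseteq \mathfrak{F}_F$ one has $\Gamma \vdash_F \varphi$ if and only if $\Gamma \vDash_{\mathfrak{A}_F, D} \varphi$.
   Context: Let $\Pi$ be an infinite set of propositional letters, containing distinct letters $p_1, p_2, \dots$. The set $\mathfrak{F}$ of formulas is built from $\Pi$ with the binary connectives $\land, \lor, \to$ and the unary connective $\neg$. A fragment is any subset $F$ of $\{\land,\lor,\to,\neg\}$; $\mathfrak{F}_F$ is the set of formulas built from $\Pi$ using only connectives in $F$. Derivability $\vdash_F$ is the smallest relation between sets of formulas of $\mathfrak{F}_F$ and formulas of $\mathfrak{F}_F$ satisfying the structural rules (R$_\in$), (R$_m$), (R$_t$) and those of the other rules below that concern connectives in $F$: (R$_\in$) if $\varphi \in \Gamma$, then $\Gamma \vdash \varphi$; (R$_m$) if $\Gamma \vdash \varphi$, then $\Gamma, \psi \vdash \varphi$; (R$_t$) if $\Gamma \vdash \varphi$ and $\Delta, \varphi \vdash \psi$, then $\Gamma, \Delta \vdash \psi$; (R$_\land$) $\Gamma \vdash \varphi \land \psi$ iff $\Gamma \vdash \varphi$ and $\Gamma \vdash \psi$; (R$_\lor$) $\Gamma, \varphi \lor \psi \vdash \chi$ iff $\Gamma, \varphi \vdash \chi$ and $\Gamma, \psi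 \vdash \chi$; (R$_\to$) $\Gamma \vdash \varphi \to \psi$ iff $\Gamma, \varphi \vdash \psi$; (R$_{\neg I}$) if $\Gamma, \varphi \vdash \psi$ and $\Gamma, \varphi \vdash \neg\psi$, then $\Gamma \vdash \neg\varphi$; (R$_{\neg E}$) if $\Gamma \vdash \varphi$ and $\Gamma \vdash \neg\varphi$, then $\Gamma \vdash \psi$. An algebra $\mathfrak{A}_F$ for $F$ has a nonempty universe $V$ and one operation on $V$ of the corresponding arity for each connective in $F$. For $D \subseteq V$ and $\Gamma \cup \{\varphi\} \subseteq \mathfrak{F}_F$, $\Gamma \vDash_{\mathfrak{A}_F, D} \varphi$ means: for every assignment $v : \Pi \to V$, with unique homomorphic extension $\bar v : \mathfrak{F}_F \to V$, if $\bar v(\psi) \in D$ for all $\psi \in \Gamma$, then $\bar v(\varphi) \in D$. *)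

theory Defs imports Main begin

datatype connective = AND | OR | IMP | NOT

text \<open>
  The type \<open>'p\<close> is the set of propositional letters; that it is infinite is an assumption
  of the theorem. Formulas over all four connectives form one type, and the formulas of a
  fragment \<open>F\<close> are a subset of it.
\<close>

datatype 'p form =
    Atom 'p
  | Conj "'p form" "'p form"
  | Disj "'p form" "'p form"
  | Impl "'p form" "'p form"
  | Neg "'p form"

inductive_set forms :: "connective set \<Rightarrow> 'p form set" for F :: "connective set" where
  Atom: "Atom p \<in> forms F"
| Conj: "AND \<in> F \<Longrightarrow> \<phi> \<in> forms F \<Longrightarrow> \<psi> \<in> forms F \<Longrightarrow> Conj \<phi> \<psi> \<in> forms F"
| Disj: "OR \<in> F \<Longrightarrow> \<phi> \<in> forms F \<Longrightarrow> \<psi> \<in> forms F \<Longrightarrow> Disj \<phi> \<psi> \<in> forms F"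
| Impl: "IMP \<in> F \<Longrightarrow> \<phi> \<in> forms F \<Longrightarrow> \<psi> \<in> forms F \<Longrightarrow> Impl \<phi> \<psi> \<in> forms F"
| Neg: "NOT \<in> F \<Longrightarrow> \<phi> \<in> forms F \<Longrightarrow> Neg \<phi> \<in> forms F"

text \<open>
  Each rule stated as an equivalence is split into its directions. Membership in \<open>forms F\<close>
  is required only of formulas for which it does not follow from the premises, so the relation
  holds only between sets of \<open>F\<close>-formulas and \<open>F\<close>-formulas (\<open>derivable_forms\<close> below).
  Antecedents are arbitrary, possibly infinite, sets.
\<close>

inductive derivable :: "'p form set \<Rightarrow> connective set \<Rightarrow> 'p form \<Rightarrow> bool"
    ("(_ \<turnstile>\<^bsub>_\<^esub> _)" [51, 0, 51] 50) where
  R_in: "\<Gamma> \<subseteq> forms F \<Longrightarrow> \<phi> \<in> \<Gamma> \<Longrightarrow> \<Gamma> \<turnstile>\<^bsub>F\<^esub> \<phi>"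
| R_m: "\<psi> \<in> forms F \<Longrightarrow> \<Gamma> \<turnstile>\<^bsub>F\<^esub> \<phi> \<Longrightarrow> insert \<psi> \<Gamma> \<turnstile>\<^bsub>F\<^esub> \<phi>"
| R_t: "\<Gamma> \<turnstile>\<^bsub>F\<^esub> \<phi> \<Longrightarrow> insert \<phi> \<Delta> \<turnstile>\<^bsub>F\<^esub> \<psi> \<Longrightarrow> \<Gamma> \<union> \<Delta> \<turnstile>\<^bsub>F\<^esub> \<psi>"
| R_conj1: "AND \<in> F \<Longrightarrow> \<Gamma> \<turnstile>\<^bsub>F\<^esub> Conj \<phi> \<psi> \<Longrightarrow> \<Gamma> \<turnstile>\<^bsub>F\<^esub> \<phi>"
| R_conj2: "AND \<in> F \<Longrightarrow> \<Gamma> \<turnstile>\<^bsub>F\<^esub> Conj \<phi> \<psi> \<Longrightarrow> \<Gamma> \<turnstile>\<^bsub>F\<^esub> \<psi>"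
| R_conj: "AND \<in> F \<Longrightarrow> \<Gamma> \<turnstile>\<^bsub>F\<^esub> \<phi> \<Longrightarrow> \<Gamma> \<turnstile>\<^bsub>F\<^esub> \<psi> \<Longrightarrow> \<Gamma> \<turnstile>\<^bsub>F\<^esub> Conj \<phi> \<psi>"
| R_disj1: "OR \<in> F \<Longrightarrow> insert (Disj \<phi> \<psi>) \<Gamma> \<turnstile>\<^bsub>F\<^esub> \<chi> \<Longrightarrow> insert \<phi> \<Gamma> \<turnstile>\<^bsub>F\<^esub> \<chi>"
| R_disj2: "OR \<in> F \<Longrightarrow> insert (Disj \<phi> \<psi>) \<Gamma> \<turnstile>\<^bsub>F\<^esub> \<chi> \<Longrightarrow> insert \<psi> \<Gamma> \<turnstile>\<^bsub>F\<^esub> \<chi>"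
| R_disj: "OR \<in> F \<Longrightarrow> insert \<phi> \<Gamma> \<turnstile>\<^bsub>F\<^esub> \<chi> \<Longrightarrow> insert \<psi> \<Gamma> \<turnstile>\<^bsub>F\<^esub> \<chi> \<Longrightarrow>
    insert (Disj \<phi> \<psi>) \<Gamma> \<turnstile>\<^bsub>F\<^esub> \<chi>"
| R_impl1: "IMP \<in> F \<Longrightarrow> \<Gamma> \<turnstile>\<^bsub>F\<^esub> Impl \<phi> \<psi> \<Longrightarrow> insert \<phi> \<Gamma> \<turnstile>\<^bsub>F\<^esub> \<psi>"
| R_impl: "IMP \<in> F \<Longrightarrow> insert \<phi> \<Gamma> \<turnstile>\<^bsub>F\<^esub> \<psi> \<Longrightarrow> \<Gamma> \<turnstile>\<^bsub>F\<^esub> Impl \<phi> \<psi>"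
| R_negI: "NOT \<in> F \<Longrightarrow> insert \<phi> \<Gamma> \<turnstile>\<^bsub>F\<^esub> \<psi> \<Longrightarrow> insert \<phi> \<Gamma> \<turnstile>\<^bsub>F\<^esub> Neg \<psi> \<Longrightarrow> \<Gamma> \<turnstile>\<^bsub>F\<^esub> Neg \<phi>"
| R_negE: "NOT \<in> F \<Longrightarrow> \<psi> \<in> forms F \<Longrightarrow> \<Gamma> \<turnstile>\<^bsub>F\<^esub> \<phi> \<Longrightarrow> \<Gamma> \<turnstile>\<^bsub>F\<^esub> Neg \<phi> \<Longrightarrow> \<Gamma> \<turnstile>\<^bsub>F\<^esub> \<psi>"

lemma forms_iff [simp]:
  "Conj \<phi> \<psi> \<in> forms F \<longleftrightarrow> AND \<in> F \<and> \<phi> \<in> forms F \<and> \<psi> \<in> forms F"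
  "Disj \<phi> \<psi> \<in> forms F \<longleftrightarrow> OR \<in> F \<and> \<phi> \<in> forms F \<and> \<psi> \<in> forms F"
  "Impl \<phi> \<psi> \<in> forms F \<longleftrightarrow> IMP \<in> F \<and> \<phi> \<in> forms F \<and> \<psi> \<in> forms F"
  "Neg \<phi> \<in> forms F \<longleftrightarrow> NOT \<in> F \<and> \<phi> \<in> forms F"
  "Atom p \<in> forms F"
  by (auto elim: forms.cases intro: forms.intros)

lemma derivable_forms: "\<Gamma> \<turnstile>\<^bsub>F\<^esub> \<phi> \<Longrightarrow> insert \<phi> \<Gamma> \<subseteq> forms F"
  by (induction rule: derivable.induct) auto

text \<open>
  The record has a field for every connective; the operations of connectives outside \<open>F\<close>
  are unconstrained and irrelevant, since \<open>F\<close>-formulas never use them.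
\<close>

record 'v algebra =
  universe :: "'v set"
  conj_op :: "'v \<Rightarrow> 'v \<Rightarrow> 'v"
  disj_op :: "'v \<Rightarrow> 'v \<Rightarrow> 'v"
  impl_op :: "'v \<Rightarrow> 'v \<Rightarrow> 'v"
  neg_op :: "'v \<Rightarrow> 'v"

definition is_algebra :: "connective set \<Rightarrow> 'v algebra \<Rightarrow> bool" where
  "is_algebra F A \<longleftrightarrow>
     universe A \<noteq> {} \<and>
     (AND \<in> F \<longrightarrow> (\<forall>x\<in>universe A. \<forall>y\<in>universe A. conj_op A x y \<in> universe A)) \<and>
     (OR \<in> F \<longrightarrow> (\<forall>x\<in>universe A. \<forall>y\<in>universe A. disj_op A x y \<in> universe A)) \<and>
     (IMP \<in> F \<longrightarrow> (\<forall>x\<in>universe A. \<forall>y\<in>universe A. impl_op A x y \<in> universe A)) \<and>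
     (NOT \<in> F \<longrightarrow> (\<forall>x\<in>universe A. neg_op A x \<in> universe A))"

primrec eval :: "'v algebra \<Rightarrow> ('p \<Rightarrow> 'v) \<Rightarrow> 'p form \<Rightarrow> 'v" where
  "eval A v (Atom p) = v p"
| "eval A v (Conj \<phi> \<psi>) = conj_op A (eval A v \<phi>) (eval A v \<psi>)"
| "eval A v (Disj \<phi> \<psi>) = disj_op A (eval A v \<phi>) (eval A v \<psi>)"
| "eval A v (Impl \<phi> \<psi>) = impl_op A (eval A v \<phi>) (eval A v \<psi>)"
| "eval A v (Neg \<phi>) = neg_op A (eval A v \<phi>)"

lemma eval_in_universe:
  assumes "is_algebra F A" "\<And>p. v p \<in> universe A" "\<phi> \<in> forms F"
  shows "eval A v \<phi> \<in> universe A"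
  using assms(3) by induction (use assms(1,2) in \<open>auto simp: is_algebra_def\<close>)

definition entails :: "'p form set \<Rightarrow> 'v algebra \<Rightarrow> 'v set \<Rightarrow> 'p form \<Rightarrow> bool"
    ("(_ \<Turnstile>\<^bsub>_,_\<^esub> _)" [51, 0, 0, 51] 50) where
  "\<Gamma> \<Turnstile>\<^bsub>A,D\<^esub> \<phi> \<longleftrightarrow>
     (\<forall>v. (\<forall>p. v p \<in> universe A) \<longrightarrow> (\<forall>\<psi>\<in>\<Gamma>. eval A v \<psi> \<in> D) \<longrightarrow> eval A v \<phi> \<in> D)"

end

theory Submission imports Defs begin

text \<open>
  The argument is a variant of Goedel's proof that intuitionistic logic has no finite
  characteristic matrix. Goedel's disjunction of equivalences between letters is replaced by a
  disjunction, over all pairs of distinct letters \<open>p\<close>, \<open>q\<close> from a finite set \<open>S\<close>, of the formulas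
  \<open>\<not>\<not>(p \<or> \<not>q)\<close>, which need only disjunction and negation.

  This disjunction is not derivable (\<open>separation_not_derivable\<close>): it fails at the root of the
  Kripke model that has, above a root forcing no letter, one maximal world for every letter,
  forcing that letter alone. At the world of \<open>q\<close> the formula \<open>p \<or> \<not>q\<close> is false, hence \<open>\<not>\<not>(p \<or> \<not>q)\<close>
  is not forced at the root, and the root refutes all the disjuncts simultaneously. Yet as soon
  as two letters of \<open>S\<close> are identified, one disjunct becomes \<open>\<not>\<not>(q \<or> \<not>q)\<close> and the disjunction
  becomes derivable (\<open>separation_collapse\<close>).

  A matrix with fewer values than \<open>S\<close> has letters cannot tell these two situations apart: an
  assignment refuting the disjunction gives two letters of \<open>S\<close> the same value, so it also
  refutes the result of identifying them, although that result is derivable.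
\<close>

section \<open>Kripke soundness\<close>

primrec forces :: "('w \<Rightarrow> 'w \<Rightarrow> bool) \<Rightarrow> ('w \<Rightarrow> 'p \<Rightarrow> bool) \<Rightarrow> 'w \<Rightarrow> 'p form \<Rightarrow> bool" where
  "forces R V w (Atom p) \<longleftrightarrow> V w p"
| "forces R V w (Conj \<phi> \<psi>) \<longleftrightarrow> forces R V w \<phi> \<and> forces R V w \<psi>"
| "forces R V w (Disj \<phi> \<psi>) \<longleftrightarrow> forces R V w \<phi> \<or> forces R V w \<psi>"
| "forces R V w (Impl \<phi> \<psi>) \<longleftrightarrow> (\<forall>u. R w u \<longrightarrow> forces R V u \<phi> \<longrightarrow> forces R V u \<psi>)"
| "forces R V w (Neg \<phi>) \<longleftrightarrow> (\<forall>u. R w u \<longrightarrow> \<not> forces R V u \<phi>)"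

lemma forces_mono:
  assumes "transp R" and "\<And>w u p. R w u \<Longrightarrow> V w p \<Longrightarrow> V u p"
  shows "R w u \<Longrightarrow> forces R V w \<phi> \<Longrightarrow> forces R V u \<phi>"
proof (induction \<phi> arbitrary: w u)
  case (Atom p)
  then show ?case using assms(2) by simp
next
  case (Impl \<phi> \<psi>)
  then show ?case using transpD[OF assms(1) Impl.prems(1)] by simp
next
  case (Neg \<phi>)
  then show ?case using transpD[OF assms(1) Neg.prems(1)] by simp
qed auto

text \<open>
  Rules that discharge a hypothesis are where all worlds must be treated at once: the premise is
  used at a later world, at which the remaining hypotheses persist.
\<close>

lemma kripke_soundness:
  assumes R: "reflp R" "transp R" and V: "\<And>w u p. R w u \<Longrightarrow> V w p \<Longrightarrow> V u p"
    and "\<Gamma> \<turnstile>\<^bsub>F\<^esub> \<phi>" "\<forall>\<psi>\<in>\<Gamma>. forces R V w \<psi>"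
  shows "forces R V w \<phi>"
proof -
  have persistent: "forces R V w \<phi> \<Longrightarrow> R w u \<Longrightarrow> forces R V u \<phi>" for w u and \<phi>
    using V by (rule forces_mono[OF R(2)])
  from assms(4,5) show ?thesis
  proof (induction arbitrary: w rule: derivable.induct)
    case (R_impl1 F \<Gamma> \<phi> \<psi>)
    then show ?case using reflpD[OF R(1)] by auto
  next
    case (R_impl F \<phi> \<Gamma> \<psi>)
    show ?case
    proof (unfold forces.simps, intro allI impI)
      fix u assume "R w u" "forces R V u \<phi>"
      with R_impl.prems have "\<forall>\<chi>\<in>insert \<phi> \<Gamma>. forces R V u \<chi>"
        using persistent by blast
      then show "forces R V u \<psi>"
        by (rule R_impl.IH)
    qed
  next
    case (R_negI F \<phi> \<Gamma> \<psi>)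
    show ?case
    proof (unfold forces.simps, intro allI impI notI)
      fix u assume u: "R w u" "forces R V u \<phi>"
      with R_negI.prems have "\<forall>\<chi>\<in>insert \<phi> \<Gamma>. forces R V u \<chi>"
        using persistent by blast
      then have "forces R V u \<psi>" "forces R V u (Neg \<psi>)"
        using R_negI.IH by blast+
      then show False using reflpD[OF R(1)] by auto
    qed
  next
    case (R_negE F \<psi> \<Gamma> \<phi>)
    then show ?case using reflpD[OF R(1)] by fastforce
  qed auto
qed

section \<open>Derivations with disjunction and negation\<close>

lemma derivable_disjI1:
  assumes "OR \<in> F" "\<Gamma> \<turnstile>\<^bsub>F\<^esub> \<phi>" "\<psi> \<in> forms F"
  shows "\<Gamma> \<turnstile>\<^bsub>F\<^esub> Disj \<phi> \<psi>"
proof -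
  have "insert (Disj \<phi> \<psi>) {} \<turnstile>\<^bsub>F\<^esub> Disj \<phi> \<psi>"
    using assms derivable_forms[OF assms(2)] by (intro R_in) auto
  then have "insert \<phi> {} \<turnstile>\<^bsub>F\<^esub> Disj \<phi> \<psi>"
    using assms(1) by (rule R_disj1[rotated])
  from R_t[OF assms(2) this] show ?thesis by simp
qed

lemma derivable_disjI2:
  assumes "OR \<in> F" "\<Gamma> \<turnstile>\<^bsub>F\<^esub> \<psi>" "\<phi> \<in> forms F"
  shows "\<Gamma> \<turnstile>\<^bsub>F\<^esub> Disj \<phi> \<psi>"
proof -
  have "insert (Disj \<phi> \<psi>) {} \<turnstile>\<^bsub>F\<^esub> Disj \<phi> \<psi>"
    using assms derivable_forms[OF assms(2)] by (intro R_in) auto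
  then have "insert \<psi> {} \<turnstile>\<^bsub>F\<^esub> Disj \<phi> \<psi>"
    using assms(1) by (rule R_disj2[rotated])
  from R_t[OF assms(2) this] show ?thesis by simp
qed

lemma derivable_foldr_Disj:
  assumes "OR \<in> F" "\<chi> \<in> set \<phi>s" "{} \<turnstile>\<^bsub>F\<^esub> \<chi>" "set \<phi>s \<subseteq> forms F" "\<beta> \<in> forms F"
  shows "{} \<turnstile>\<^bsub>F\<^esub> foldr Disj \<phi>s \<beta>"
  using assms(2,4)
proof (induction \<phi>s)
  case (Cons \<phi> \<phi>s)
  have rest: "foldr Disj \<phi>s \<beta> \<in> forms F"
    using Cons.prems(2) assms(1,5) by (induction \<phi>s) auto
  show ?case
  proof (cases "\<chi> = \<phi>")
    case True
    with assms(1,3) rest show ?thesis by (simp add: derivable_disjI1)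
  next
    case False
    with Cons assms(1) show ?thesis by (simp add: derivable_disjI2)
  qed
qed simp

lemma derivable_not_not_excluded_middle:
  assumes "OR \<in> F" "NOT \<in> F" "\<phi> \<in> forms F"
  shows "{} \<turnstile>\<^bsub>F\<^esub> Neg (Neg (Disj \<phi> (Neg \<phi>)))"
proof -
  let ?em = "Disj \<phi> (Neg \<phi>)"
  have "{\<phi>, Neg ?em} \<turnstile>\<^bsub>F\<^esub> ?em"
    using assms by (intro derivable_disjI1 R_in) auto
  moreover have "{\<phi>, Neg ?em} \<turnstile>\<^bsub>F\<^esub> Neg ?em"
    using assms by (intro R_in) auto
  ultimately have "{Neg ?em} \<turnstile>\<^bsub>F\<^esub> Neg \<phi>"
    by (rule R_negI[OF assms(2)])
  with assms have "{Neg ?em} \<turnstile>\<^bsub>F\<^esub> ?em"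
    by (simp add: derivable_disjI2)
  moreover have "{Neg ?em} \<turnstile>\<^bsub>F\<^esub> Neg ?em"
    using assms by (intro R_in) auto
  ultimately show ?thesis
    by (rule R_negI[OF assms(2)])
qed

section \<open>The separating disjunction\<close>

text \<open>
  The letter \<open>c\<close> stands in for the empty disjunction, as the fragment has no constant for falsity;
  it serves because the root of the refuting model forces no letter.
\<close>

definition separation :: "('p \<times> 'p) list \<Rightarrow> 'p \<Rightarrow> 'p form" where
  "separation ps c =
     foldr Disj (map (\<lambda>(p, q). Neg (Neg (Disj (Atom p) (Neg (Atom q))))) ps) (Atom c)"

lemma separation_in_forms:
  "{OR, NOT} \<subseteq> F \<Longrightarrow> separation ps c \<in> forms F"
  by (induction ps) (auto simp: separation_def)

lemma map_form_separation:
  "map_form f (separation ps c) = separation (map (map_prod f f) ps) (f c)"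
  by (induction ps) (auto simp: separation_def)

text \<open>
  The disjuncts are doubly negated so that each can be refuted at the root by a single maximal
  world; the worlds of different letters then refute all of them together, since a disjunction
  is forced at the root only through one of its members.
\<close>

lemma separation_not_derivable:
  assumes "\<forall>(p, q)\<in>set ps. p \<noteq> q"
  shows "\<not> {} \<turnstile>\<^bsub>F\<^esub> separation ps c"
proof
  \<comment> \<open>\<open>None\<close> is the root and \<open>Some q\<close> the maximal world forcing the letter \<open>q\<close> alone.\<close>
  let ?R = "\<lambda>w u :: 'a option. w = None \<or> w = u"
  let ?V = "\<lambda>w q. w = Some q"
  assume "{} \<turnstile>\<^bsub>F\<^esub> separation ps c"
  then have "forces ?R ?V None (separation ps c)"
    by (intro kripke_soundness[of ?R ?V]) (auto simp: reflp_def transp_def)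
  moreover have "\<not> forces ?R ?V None (separation ps c)"
    using assms
  proof (induction ps)
    case (Cons pq ps)
    obtain p q where pq: "pq = (p, q)" by (cases pq)
    with Cons.prems have "\<not> forces ?R ?V u (Disj (Atom p) (Neg (Atom q)))" if "u = Some q" for u
      using that by auto
    then have "\<not> forces ?R ?V None (Neg (Neg (Disj (Atom p) (Neg (Atom q)))))"
      by fastforce
    with Cons pq show ?case by (simp add: separation_def)
  qed (simp add: separation_def)
  ultimately show False by blast
qed

text \<open>
  Identifying the letters of one disjunct turns it into the double negation of an instance of
  excluded middle, which already suffices to derive the disjunction.
\<close>

lemma separation_collapse:
  assumes "{OR, NOT} \<subseteq> F" "(p, q) \<in> set ps" "f p = f q"
  shows "{} \<turnstile>\<^bsub>F\<^esub> map_form f (separation ps c)"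
proof -
  let ?disjunct = "\<lambda>(p, q). Neg (Neg (Disj (Atom p) (Neg (Atom q))))"
  let ?qs = "map (map_prod f f) ps"
  have derivable: "{} \<turnstile>\<^bsub>F\<^esub> ?disjunct (f q, f q)"
    using assms(1) by (simp add: derivable_not_not_excluded_middle)
  have "map_prod f f (p, q) \<in> set ?qs"
    unfolding set_map using assms(2) by (rule imageI)
  then have "(f q, f q) \<in> set ?qs"
    using assms(3) by simp
  then have "?disjunct (f q, f q) \<in> set (map ?disjunct ?qs)"
    unfolding set_map[of ?disjunct] by (rule imageI)
  moreover have "set (map ?disjunct ?qs) \<subseteq> forms F"
    using assms(1) by auto
  ultimately show ?thesis
    unfolding map_form_separation unfolding separation_def
    by (intro derivable_foldr_Disj[OF _ _ derivable]) (use assms(1) in simp_all)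
qed

section \<open>No finite matrix\<close>

lemma eval_map_form: "eval A v (map_form f \<phi>) = eval A (v \<circ> f) \<phi>"
  by (induction \<phi>) auto

theorem theorem2:
  fixes F :: "connective set"
  assumes "infinite (UNIV :: 'p set)"
    and "{OR, NOT} \<subseteq> F"
  shows "\<not> (\<exists>(A :: 'v algebra) D.
    is_algebra F A \<and> finite (universe A) \<and> D \<subseteq> universe A \<and>
    (\<forall>(\<Gamma> :: 'p form set) \<phi>. insert \<phi> \<Gamma> \<subseteq> forms F \<longrightarrow>
       (\<Gamma> \<turnstile>\<^bsub>F\<^esub> \<phi> \<longleftrightarrow> \<Gamma> \<Turnstile>\<^bsub>A,D\<^esub> \<phi>)))"
proof
  assume "\<exists>(A :: 'v algebra) D.
    is_algebra F A \<and> finite (universe A) \<and> D \<subseteq> universe A \<and>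
    (\<forall>(\<Gamma> :: 'p form set) \<phi>. insert \<phi> \<Gamma> \<subseteq> forms F \<longrightarrow>
       (\<Gamma> \<turnstile>\<^bsub>F\<^esub> \<phi> \<longleftrightarrow> \<Gamma> \<Turnstile>\<^bsub>A,D\<^esub> \<phi>))"
  then obtain A :: "'v algebra" and D where fin: "finite (universe A)"
    and complete: "\<And>\<phi> :: 'p form. \<phi> \<in> forms F \<Longrightarrow> {} \<turnstile>\<^bsub>F\<^esub> \<phi> \<longleftrightarrow> {} \<Turnstile>\<^bsub>A,D\<^esub> \<phi>"
    by auto
  obtain S :: "'p set" where S: "finite S" "card S = Suc (card (universe A))"
    using infinite_arbitrarily_large[OF assms(1)] by blast
  have "finite {(p, q). p \<in> S \<and> q \<in> S \<and> p \<noteq> q}"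
    by (rule finite_subset[of _ "S \<times> S"]) (use S(1) in auto)
  then obtain ps where ps: "set ps = {(p, q). p \<in> S \<and> q \<in> S \<and> p \<noteq> q}"
    using finite_list by blast
  obtain c :: 'p where True by blast
  let ?\<phi> = "separation ps c"
  have "\<not> {} \<Turnstile>\<^bsub>A,D\<^esub> ?\<phi>"
    using complete[OF separation_in_forms[OF assms(2)]] separation_not_derivable[of ps F c] ps
    by auto
  then obtain v where v: "\<And>p. v p \<in> universe A" "eval A v ?\<phi> \<notin> D"
    by (auto simp: entails_def)
  have "\<not> inj_on v S"
    using card_inj_on_le[of v S "universe A"] fin S(2) v(1) by auto
  then obtain p q where pq: "p \<in> S" "q \<in> S" "p \<noteq> q" "v p = v q"
    by (auto simp: inj_on_def)
  let ?f = "id(p := q)"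
  have "{} \<turnstile>\<^bsub>F\<^esub> map_form ?f ?\<phi>"
    using pq ps by (intro separation_collapse[OF assms(2), of p q]) auto
  then have "{} \<Turnstile>\<^bsub>A,D\<^esub> map_form ?f ?\<phi>"
    using complete derivable_forms by blast
  then have "eval A (v \<circ> ?f) ?\<phi> \<in> D"
    using v(1) by (auto simp: entails_def eval_map_form)
  moreover have "v \<circ> ?f = v"
    using pq(4) by auto
  ultimately show False
    using v(2) by simp
qed

end
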